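(* Consider the stationary birth-and-death equations $$\mu_{j+1}p_{j+1}-\lambda_jp_j=\mu_jp_j-\lambda_{j-1}p_{j-1}\quad (j>i),\qquad \mu_{i+1}p_{i+1}-\lambda_ip_i=0,$$ for a probability mass function $(p_j)$, with transition rates $$\lambda_j=\sum_{k=0}^{\ell}\alpha_k (j)_k,\qquad \mu_j=j\sum_{k=0}^{m}\beta_k (j-1)_k,\qquad \ell\le j,\ m\le j.$$ The unique solution of these equations is $$p_j=p_i\prod_{n=i}^{j-1}\frac{g(n)}{n+1},\qquad g(n)=\frac{(n+1)p_{n+1}}{p_n}=\frac{\sum_{k=0}^{\ell}\alpha_k (n)_k}{\sum_{k=0}^{m}\beta_k (n)_k},\qquad \ell\le j,\ m\le j,$$ where $p_i$ is the first non-zero value of the positive sequence defining the probability mass function $p_j$, i.e. $i=\min\{n\ge 0: p_n>0\}$, and hence $i$ satisfies $g(i)>0$ and $g(i-1)\le 0$.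
   Context: A continuous-time birth-and-death process is a continuous-time Markov chain $\{X(t):t\ge0\}$ with discrete state space, which changes only through transitions $n\to n\pm1$ between neighbouring states. Its time-independent transition probabilities per unit time are $\lambda_j$ for $j\to j+1$ and $\mu_j$ for $j\to j-1$. With the process started in state $i$ (that is, $p_j(0)=\delta_{ij}$), the probabilities $p_j(t)=\mathbb P(X(t)=j)$ satisfy $\frac{dp_j}{dt}=-(\lambda_j+\mu_j)p_j+\lambda_{j-1}p_{j-1}+\mu_{j+1}p_{j+1}$ for $j>i$, and $\frac{dp_i}{dt}=-\lambda_ip_i+\mu_{i+1}p_{i+1}$. The stationary equations are obtained by setting the time derivatives to zero, and the $p_j$ are the limiting probabilities $p_j=\lim_{t\to\infty}p_j(t)$. The coefficients $\alpha_k$ and $\beta_k$ are the elementary (particle-level) transition probabilities per unit time from which $\lambda_j$ and $\mu_j$ are built: for example, a particle is born with rate $\alpha_0$ or dies with rate $\beta_0 j$, one particle splits into two with rate $\alpha_1 j$, and two particles fuse into one with rate $\beta_1 j(j-1)$. Here $(x)_k=\prod_{s=0}^{k-1}(x-s)$ is the falling factorial, with $(x)_0=1$, and an empty product equals $1$.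
   Formalization: Assumes μ_j≠0 for j>i, so g is defined; g(i)>0 is claimed only if λ_i≠0 (a point mass fails); g(i-1)≤0 only for i≥1 and when no positive value at i-1 extends the solution (zero-truncated Poisson has g(0)>0). *)

theory Defs
  imports "HOL-Probability.Probability_Mass_Function"
begin

definition falling_factorial :: "real \<Rightarrow> nat \<Rightarrow> real" where
  "falling_factorial x k = (\<Prod>s<k. x - real s)"

text \<open>
  The restrictions \<open>l \<le> j\<close>, \<open>m \<le> j\<close> on the upper summation bounds need no counterpart: the
  terms that they would cut off contain \<open>(j)\<^sub>k\<close> with \<open>k > j\<close>, or \<open>j (j - 1)\<^sub>k\<close> with \<open>k > j\<close>, and vanish.
\<close>

definition birth_rate :: "(nat \<Rightarrow> real) \<Rightarrow> nat \<Rightarrow> nat \<Rightarrow> real" where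
  "birth_rate \<alpha> l j = (\<Sum>k=0..l. \<alpha> k * falling_factorial (real j) k)"

definition death_rate :: "(nat \<Rightarrow> real) \<Rightarrow> nat \<Rightarrow> nat \<Rightarrow> real" where
  "death_rate \<beta> m j = real j * (\<Sum>k=0..m. \<beta> k * falling_factorial (real j - 1) k)"

definition ratio_fun :: "(nat \<Rightarrow> real) \<Rightarrow> nat \<Rightarrow> (nat \<Rightarrow> real) \<Rightarrow> nat \<Rightarrow> nat \<Rightarrow> real" where
  "ratio_fun \<alpha> l \<beta> m n =
     (\<Sum>k=0..l. \<alpha> k * falling_factorial (real n) k) /
     (\<Sum>k=0..m. \<beta> k * falling_factorial (real n) k)"

definition stationary_from ::
  "(nat \<Rightarrow> real) \<Rightarrow> (nat \<Rightarrow> real) \<Rightarrow> nat \<Rightarrow> (nat \<Rightarrow> real) \<Rightarrow> bool" where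
  "stationary_from lam mu i p \<longleftrightarrow>
     (\<forall>j>i. mu (j + 1) * p (j + 1) - lam j * p j = mu j * p j - lam (j - 1) * p (j - 1)) \<and>
     mu (i + 1) * p (i + 1) - lam i * p i = 0"

text \<open>
  The equations from \<open>i\<close> on do not involve the edge between \<open>i - 1\<close> and \<open>i\<close>: a Poisson
  distribution truncated to \<open>{1, 2, \<dots>}\<close> solves them for \<open>i = 1\<close>, constant \<open>lam\<close> and \<open>mu j = j\<close>, although
  the ratio function is positive at \<open>0\<close>. A sign condition at \<open>i - 1\<close> needs \<open>i\<close> to be the first
  index of the positive solution sequence itself: the sequence has no continuation by a positive
  value at \<open>i - 1\<close> that satisfies the equations from \<open>i - 1\<close> on. (These are homogeneous,
  so normalisation plays no role.)  As for the start \<open>i\<close>, the start \<open>i - 1\<close> is only admitted if the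
  death rates above it do not vanish; for \<open>mu i = 0\<close> the denominator of the ratio function at
  \<open>i - 1\<close> is zero.
\<close>

definition continues_below ::
  "(nat \<Rightarrow> real) \<Rightarrow> (nat \<Rightarrow> real) \<Rightarrow> nat \<Rightarrow> (nat \<Rightarrow> real) \<Rightarrow> bool" where
  "continues_below lam mu i p \<longleftrightarrow>
     0 < i \<and> mu i \<noteq> 0 \<and> (\<exists>x>0. stationary_from lam mu (i - 1) (p(i - 1 := x)))"

end

theory Submission
  imports Defs
begin

text \<open>
  The stationary equations say that the net flow \<open>mu (j + 1) * p (j + 1) - lam j * p j\<close> across the
  edge between \<open>j\<close> and \<open>j + 1\<close> does not depend on \<open>j \<ge> i\<close>, and the boundary equation says that it is
  zero at the first edge. Hence they are equivalent to detailed balance,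
  \<open>mu (j + 1) * p (j + 1) = lam j * p j\<close> for all \<open>j \<ge> i\<close> (\<open>stationary_from_iff_detailed_balance\<close>).

  As \<open>real (n + 1) - 1 = real n\<close>, the denominator of \<open>ratio_fun\<close> at \<open>n\<close> is the death rate at \<open>n + 1\<close>
  without its factor \<open>n + 1\<close>, so \<open>g n / (n + 1) = lam n / mu (n + 1)\<close>. Where the death rates do not
  vanish, detailed balance is therefore a first-order recursion with factors \<open>g n / (n + 1)\<close>, whose
  solutions are the multiples of the product in the theorem. Two probability mass functions
  that start at \<open>i\<close> and solve it are multiples of each other, and normalisation makes
  them equal (\<open>pmf_eq_if_proportional\<close>).

  Both sign conditions come from reading the recursion at one edge. At the edge above \<open>i\<close> it gives
  \<open>g i = (i + 1) * p (i + 1) / p i \<ge> 0\<close>, and \<open>g i\<close> is zero only if \<open>lam i\<close> is. At the edge below \<open>i\<close>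
  it demands the value \<open>i * p i / g (i - 1)\<close> at \<open>i - 1\<close>; if \<open>g (i - 1) > 0\<close>, this value is positive
  and continues the solution below \<open>i\<close> (\<open>continues_below_if_ratio_pos\<close>).
\<close>

lemma stationary_from_iff_detailed_balance:
  "stationary_from lam mu i p \<longleftrightarrow> (\<forall>j\<ge>i. mu (j + 1) * p (j + 1) = lam j * p j)"
proof
  assume st: "stationary_from lam mu i p"
  show "\<forall>j\<ge>i. mu (j + 1) * p (j + 1) = lam j * p j"
  proof (intro allI impI)
    fix j assume "i \<le> j"
    then show "mu (j + 1) * p (j + 1) = lam j * p j"
    proof (induction rule: dec_induct)
      case base
      show ?case using st by (simp add: stationary_from_def)
    next
      case (step j)
      have "mu (Suc j + 1) * p (Suc j + 1) - lam (Suc j) * p (Suc j)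
          = mu (Suc j) * p (Suc j) - lam (Suc j - 1) * p (Suc j - 1)"
        using st step.hyps unfolding stationary_from_def by (meson le_imp_less_Suc)
      with step.IH show ?case by simp
    qed
  qed
next
  assume db: "\<forall>j\<ge>i. mu (j + 1) * p (j + 1) = lam j * p j"
  have "mu j * p j = lam (j - 1) * p (j - 1)" if "i < j" for j
    using db[rule_format, of "j - 1"] that by simp
  with db show "stationary_from lam mu i p"
    by (simp add: stationary_from_def)
qed

lemma ratio_fun_eq_rate_quotient:
  "ratio_fun \<alpha> l \<beta> m n = (real n + 1) * (birth_rate \<alpha> l n / death_rate \<beta> m (n + 1))"
proof -
  have "real n + 1 \<noteq> 0"
    by linarith
  then show ?thesis
    by (simp add: ratio_fun_def birth_rate_def death_rate_def add.commute)
qed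

lemma first_order_recursion_iff_prod:
  fixes p q :: "nat \<Rightarrow> 'a::comm_semiring_1"
  shows "(\<forall>j\<ge>i. p (j + 1) = p j * q j) \<longleftrightarrow> (\<forall>j\<ge>i. p j = p i * (\<Prod>n=i..<j. q n))"
proof
  assume rec: "\<forall>j\<ge>i. p (j + 1) = p j * q j"
  show "\<forall>j\<ge>i. p j = p i * (\<Prod>n=i..<j. q n)"
  proof (intro allI impI)
    fix j assume "i \<le> j"
    then show "p j = p i * (\<Prod>n=i..<j. q n)"
    proof (induction rule: dec_induct)
      case (step j)
      with rec show ?case by (simp add: mult.assoc)
    qed simp
  qed
next
  assume prod: "\<forall>j\<ge>i. p j = p i * (\<Prod>n=i..<j. q n)"
  show "\<forall>j\<ge>i. p (j + 1) = p j * q j"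
  proof (intro allI impI)
    fix j assume "i \<le> j"
    have "p (j + 1) = p i * (\<Prod>n=i..<j + 1. q n)"
      using prod \<open>i \<le> j\<close> trans_le_add1 by blast
    also have "\<dots> = (p i * (\<Prod>n=i..<j. q n)) * q j"
      using \<open>i \<le> j\<close> by (simp add: mult.assoc)
    also have "p i * (\<Prod>n=i..<j. q n) = p j"
      using prod \<open>i \<le> j\<close> by metis
    finally show "p (j + 1) = p j * q j" .
  qed
qed

lemma pmf_eq_if_proportional:
  assumes "\<And>x. pmf Q x = c * pmf P x"
  shows "Q = P"
proof -
  have mass: "(\<integral>x. pmf R x \<partial>count_space UNIV) = 1" for R :: "'a pmf"
    by (simp add: integral_pmf)
  have "1 = (\<integral>x. c * pmf P x \<partial>count_space UNIV)"
    using mass[of Q] assms by simp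
  also have "\<dots> = c"
    using mass[of P] by simp
  finally show ?thesis
    using assms by (simp add: pmf_eq_iff)
qed

lemma pmf_pos_at_least:
  fixes P :: "nat pmf"
  shows "0 < pmf P (LEAST n. 0 < pmf P n)"
proof -
  obtain n where "n \<in> set_pmf P"
    using set_pmf_not_empty by fastforce
  then have "0 < pmf P n"
    by (simp add: pmf_positive_iff)
  then show ?thesis by (rule LeastI)
qed

lemma pmf_zero_below_least:
  fixes P :: "nat pmf"
  assumes "n < (LEAST n. 0 < pmf P n)"
  shows "pmf P n = 0"
  using not_less_Least[OF assms] pmf_nonneg[of P n] by simp

text \<open>
  The witness for the continuation is the value that detailed balance across the edge between
  \<open>i - 1\<close> and \<open>i\<close> demands. It is \<open>i * p i\<close> divided by the ratio function at \<open>i - 1\<close>, hence positive,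
  and the balance across the edges above \<open>i\<close> does not see the changed value.
\<close>

lemma continues_below_if_ratio_pos:
  assumes st: "stationary_from (birth_rate \<alpha> l) (death_rate \<beta> m) i p"
    and "0 < i" "0 < p i" and g: "0 < ratio_fun \<alpha> l \<beta> m (i - 1)"
  shows "continues_below (birth_rate \<alpha> l) (death_rate \<beta> m) i p"
proof -
  let ?lam = "birth_rate \<alpha> l" and ?mu = "death_rate \<beta> m"
  define x where "x = p i * ?mu i / ?lam (i - 1)"
  have quot: "0 < real i * (?lam (i - 1) / ?mu i)"
    using g \<open>0 < i\<close> by (simp add: ratio_fun_eq_rate_quotient)
  then have nz: "?mu i \<noteq> 0" "?lam (i - 1) \<noteq> 0"
    by auto
  have x_eq: "x = p i * real i / (real i * (?lam (i - 1) / ?mu i))"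
    using nz \<open>0 < i\<close> by (simp add: x_def)
  have "0 < p i * real i"
    using \<open>0 < i\<close> \<open>0 < p i\<close> by simp
  then have "0 < x"
    unfolding x_eq using quot by (rule divide_pos_pos)
  moreover have "stationary_from ?lam ?mu (i - 1) (p(i - 1 := x))"
    unfolding stationary_from_iff_detailed_balance
  proof (intro allI impI)
    fix j assume "i - 1 \<le> j"
    then consider "j = i - 1" | "i \<le> j" by linarith
    then show "?mu (j + 1) * (p(i - 1 := x)) (j + 1) = ?lam j * (p(i - 1 := x)) j"
    proof cases
      case 1
      then have "j + 1 = i" "i \<noteq> i - 1"
        using \<open>0 < i\<close> by auto
      then show ?thesis using 1 nz by (simp add: x_def)
    next
      case 2
      then have "j \<noteq> i - 1" "j + 1 \<noteq> i - 1"
        using \<open>0 < i\<close> by auto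
      then show ?thesis
        using st 2 by (simp add: stationary_from_iff_detailed_balance)
    qed
  qed
  ultimately show ?thesis
    using nz \<open>0 < i\<close> by (auto simp: continues_below_def)
qed

theorem theorem5:
  fixes \<alpha> \<beta> :: "nat \<Rightarrow> real" and l m i :: nat and P :: "nat pmf"
  defines "lam \<equiv> birth_rate \<alpha> l"
    and "mu \<equiv> death_rate \<beta> m"
    and "g \<equiv> ratio_fun \<alpha> l \<beta> m"
  assumes first: "i = (LEAST n. 0 < pmf P n)"
    and deaths: "\<And>j. i < j \<Longrightarrow> mu j \<noteq> 0"
  shows
    "(stationary_from lam mu i (pmf P) \<longleftrightarrow>
        (\<forall>j\<ge>i. pmf P j = pmf P i * (\<Prod>n=i..<j. g n / (real n + 1)))) \<and>
     (stationary_from lam mu i (pmf P) \<longrightarrow>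
        (\<forall>Q. i = (LEAST n. 0 < pmf Q n) \<and> stationary_from lam mu i (pmf Q) \<longrightarrow> Q = P) \<and>
        (\<forall>n\<ge>i. pmf P n \<noteq> 0 \<longrightarrow> g n = (real n + 1) * pmf P (n + 1) / pmf P n) \<and>
        (lam i \<noteq> 0 \<longrightarrow> 0 < g i) \<and>
        (0 < i \<and> \<not> continues_below lam mu i (pmf P) \<longrightarrow> g (i - 1) \<le> 0))"
proof -
  have mu_nz: "mu (j + 1) \<noteq> 0" if "i \<le> j" for j
    using deaths[of "j + 1"] that by simp
  have g_eq: "g n = (real n + 1) * (lam n / mu (n + 1))" for n
    by (simp add: g_def lam_def mu_def ratio_fun_eq_rate_quotient)
  have pos: "0 < pmf P i"
    using pmf_pos_at_least first by simp
  have recursion: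
    "stationary_from lam mu i p \<longleftrightarrow> (\<forall>j\<ge>i. p (j + 1) = p j * (g j / (real j + 1)))" for p
  proof -
    have "mu (j + 1) * p (j + 1) = lam j * p j \<longleftrightarrow> p (j + 1) = p j * (g j / (real j + 1))"
      if "i \<le> j" for j
    proof -
      have "real j + 1 \<noteq> 0"
        by linarith
      then have "p j * (g j / (real j + 1)) = lam j * p j / mu (j + 1)"
        by (simp add: g_eq)
      then show ?thesis
        using nonzero_eq_divide_eq[OF mu_nz[OF that], of "p (j + 1)" "lam j * p j"]
        by (simp only: mult.commute[of "mu (j + 1)"])
    qed
    then show ?thesis
      unfolding stationary_from_iff_detailed_balance by blast
  qed
  have product: "stationary_from lam mu i p \<longleftrightarrow>
      (\<forall>j\<ge>i. p j = p i * (\<Prod>n=i..<j. g n / (real n + 1)))" for p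
    unfolding recursion by (rule first_order_recursion_iff_prod)
  have unique: "Q = P"
    if st: "stationary_from lam mu i (pmf P)"
      and Q: "i = (LEAST n. 0 < pmf Q n)" "stationary_from lam mu i (pmf Q)" for Q
  proof (rule pmf_eq_if_proportional)
    fix j
    show "pmf Q j = (pmf Q i / pmf P i) * pmf P j"
    proof (cases "i \<le> j")
      case True
      show ?thesis
        unfolding st[unfolded product, rule_format, OF True]
          Q(2)[unfolded product, rule_format, OF True]
        using pos by simp
    next
      case False
      then show ?thesis
        using pmf_zero_below_least[of j P] pmf_zero_below_least[of j Q] first Q(1) by simp
    qed
  qed
  have ratio: "g n = (real n + 1) * pmf P (n + 1) / pmf P n"
    if "stationary_from lam mu i (pmf P)" "i \<le> n" "pmf P n \<noteq> 0" for n
  proof -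
    have "pmf P (n + 1) = pmf P n * (g n / (real n + 1))"
      using that(1)[unfolded recursion, rule_format, OF that(2)] .
    moreover have "real n + 1 \<noteq> 0"
      by linarith
    ultimately show ?thesis
      using that(3) by simp
  qed
  have g_pos: "0 < g i" if "stationary_from lam mu i (pmf P)" "lam i \<noteq> 0"
  proof -
    have "0 \<le> g i"
      using ratio[OF that(1)] pos by simp
    moreover have "real i + 1 \<noteq> 0"
      by linarith
    then have "g i \<noteq> 0"
      using that(2) mu_nz[of i] by (simp add: g_eq)
    ultimately show ?thesis by simp
  qed
  have g_nonpos: "g (i - 1) \<le> 0"
    if "stationary_from lam mu i (pmf P)" "0 < i" "\<not> continues_below lam mu i (pmf P)"
    using continues_below_if_ratio_pos[of \<alpha> l \<beta> m i "pmf P"] that pos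
    unfolding lam_def mu_def g_def by linarith
  show ?thesis
    by (intro conjI impI allI; (elim conjE)?) (fact product unique ratio g_pos g_nonpos)+
qed

end
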